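(* Let $n\geq 4$. The star graph $\mathrm{St}_n$ is, up to isomorphism, the unique connected $n$-vertex simple graph whose chromatic symmetric function cannot be expressed as a $\mathbb{Q}$-linear combination of the chromatic symmetric functions of other connected $n$-vertex graphs. That is, for a connected $n$-vertex simple graph $G$, $X_G\notin\mathrm{span}_{\mathbb{Q}}\{X_H: H\text{ a connected }n\text{-vertex simple graph not isomorphic to }G\}$ if and only if $G\cong\mathrm{St}_n$.
   Context: For a finite simple graph $G=(V,E)$, a proper colouring is a function $\kappa:V\to\{1,2,3,\ldots\}$ with $\kappa(u)\neq\kappa(v)$ whenever $\{u,v\}\in E$. The chromatic symmetric function of $G$ is $X_G=\sum_{\kappa\text{ proper}}\prod_{v\in V}x_{\kappa(v)}$, a symmetric function in commuting variables $x_1,x_2,\ldots$. The star $\mathrm{St}_n$ is the $n$-vertex tree in which $n-1$ leaves are joined to a single central vertex. Graphs are considered up to isomorphism. *)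

theory Defs
  imports
    "Graph_Theory.Graph_Theory"
    "HOL-Library.Multiset"
    "HOL-Library.FuncSet"
    "HOL-Library.Function_Algebras"
begin

text \<open>
  A finite simple graph is a \<^locale>\<open>pair_graph\<close>: an edge \<open>{u,v}\<close> is represented by the two
  arcs \<open>(u,v)\<close> and \<open>(v,u)\<close>.
\<close>

definition connected_graph_on :: "nat \<Rightarrow> 'a pair_pre_digraph \<Rightarrow> bool" where
  "connected_graph_on n G \<longleftrightarrow>
     pair_graph G \<and> connected (with_proj G) \<and> card (pverts G) = n"

definition graph_iso :: "'a pair_pre_digraph \<Rightarrow> 'b pair_pre_digraph \<Rightarrow> bool" where
  "graph_iso G H \<longleftrightarrow> digraph_iso (with_proj G) (with_proj H)"

definition star_graph :: "nat \<Rightarrow> nat pair_pre_digraph" where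
  "star_graph n =
     \<lparr> pverts = {..<n},
       parcs = {0} \<times> {1..<n} \<union> {1..<n} \<times> {0} \<rparr>"

text \<open>
  Colourings are functions on the vertex set, hence extensional outside of it.
\<close>

definition proper_colourings :: "'a pair_pre_digraph \<Rightarrow> ('a \<Rightarrow> nat) set" where
  "proper_colourings G =
     {\<kappa> \<in> pverts G \<rightarrow>\<^sub>E {1..}. \<forall>(u, v) \<in> parcs G. \<kappa> u \<noteq> \<kappa> v}"

text \<open>
  The monomial \<open>x\<^bsub>i1\<^esub> \<cdots> x\<^bsub>ik\<^esub>\<close> is the multiset \<open>{#i1, \<dots>, ik#}\<close>, and a formal power series in
  \<open>x\<^sub>1, x\<^sub>2, \<dots>\<close> over the rationals is its coefficient function, with pointwise addition.
\<close>

type_synonym power_series = "nat multiset \<Rightarrow> rat"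

definition series_scale :: "rat \<Rightarrow> power_series \<Rightarrow> power_series" where
  "series_scale c F = (\<lambda>m. c * F m)"

interpretation series: vector_space series_scale
  by unfold_locales (auto simp: series_scale_def fun_eq_iff algebra_simps)

definition colouring_monomial :: "'a pair_pre_digraph \<Rightarrow> ('a \<Rightarrow> nat) \<Rightarrow> nat multiset" where
  "colouring_monomial G \<kappa> = image_mset \<kappa> (mset_set (pverts G))"

text \<open>
  The formal sum of the monomials of all proper colourings: the coefficient of a monomial counts
  the colourings that contribute it. There are finitely many of these, see below.
\<close>

definition chromatic_symmetric_function :: "'a pair_pre_digraph \<Rightarrow> power_series" where
  "chromatic_symmetric_function G =
     (\<lambda>m. of_nat (card {\<kappa> \<in> proper_colourings G. colouring_monomial G \<kappa> = m}))"

lemma finite_colourings_of_monomial: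
  assumes "finite (pverts G)"
  shows "finite {\<kappa> \<in> proper_colourings G. colouring_monomial G \<kappa> = m}"
proof (rule finite_subset)
  show "{\<kappa> \<in> proper_colourings G. colouring_monomial G \<kappa> = m} \<subseteq> pverts G \<rightarrow>\<^sub>E set_mset m"
    using assms by (auto simp: proper_colourings_def colouring_monomial_def PiE_iff extensional_def)
  show "finite (pverts G \<rightarrow>\<^sub>E set_mset m)"
    using assms by (intro finite_PiE) auto
qed

text \<open>The encodings unfold to the usual notions.\<close>

lemma graph_iso_iff:
  assumes "pair_graph G" "pair_graph H"
  shows "graph_iso G H \<longleftrightarrow>
    (\<exists>f. bij_betw f (pverts G) (pverts H) \<and>
         (\<forall>u \<in> pverts G. \<forall>v \<in> pverts G. (u, v) \<in> parcs G \<longleftrightarrow> (f u, f v) \<in> parcs H))"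
    (is "_ \<longleftrightarrow> (\<exists>f. ?P f)")
proof
  interpret G: pair_graph G by fact
  interpret H: pair_graph H by fact
  assume "graph_iso G H"
  then obtain h where h: "pre_digraph.digraph_isomorphism (with_proj G) h"
    and H: "with_proj H = app_iso h (with_proj G)"
    by (auto simp: graph_iso_def digraph_iso_def)
  let ?f = "iso_verts h"
  have inj: "inj_on ?f (pverts G)"
    using h by (simp add: pre_digraph.digraph_isomorphism_def)
  have V: "pverts H = ?f ` pverts G" and A: "parcs H = iso_arcs h ` parcs G"
    and t: "iso_tail h = fst" and hd: "iso_head h = snd"
    using H by (auto simp: app_iso_def with_proj_def)
  have arc: "iso_arcs h a = (?f (fst a), ?f (snd a))" if "a \<in> parcs G" for a
    using h that t hd by (auto simp: pre_digraph.digraph_isomorphism_def prod_eq_iff)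
  have A': "parcs H = (\<lambda>a. (?f (fst a), ?f (snd a))) ` parcs G"
    unfolding A by (rule image_cong) (auto simp: arc)
  have "(u, v) \<in> parcs G \<longleftrightarrow> (?f u, ?f v) \<in> parcs H" if "u \<in> pverts G" "v \<in> pverts G" for u v
  proof
    assume "(u, v) \<in> parcs G"
    then show "(?f u, ?f v) \<in> parcs H" unfolding A' by (rule rev_image_eqI) simp
  next
    assume "(?f u, ?f v) \<in> parcs H"
    then obtain u' v' where a: "(u', v') \<in> parcs G" and e: "?f u = ?f u'" "?f v = ?f v'"
      unfolding A' by auto
    have "u' \<in> pverts G" "v' \<in> pverts G"
      using a G.in_arcsD1 G.in_arcsD2 by blast+
    then have "u = u'" "v = v'"
      using that e inj by (blast dest: inj_onD)+
    then show "(u, v) \<in> parcs G" using a by simp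
  qed
  then have "?P ?f" using inj V by (auto simp: bij_betw_def)
  then show "\<exists>f. ?P f" by blast
next
  interpret G: pair_graph G by fact
  interpret H: pair_graph H by fact
  assume "\<exists>f. ?P f"
  then obtain f where f: "?P f" by blast
  let ?h = "\<lparr> iso_verts = f, iso_arcs = map_prod f f, iso_head = snd, iso_tail = fst \<rparr>"
  have inj: "inj_on f (pverts G)" and V: "f ` pverts G = pverts H"
    using f by (auto simp: bij_betw_def)
  have A: "parcs H = map_prod f f ` parcs G"
  proof (intro equalityI subsetI)
    fix a assume a: "a \<in> parcs H"
    obtain x y where xy: "a = (x, y)" by (cases a)
    have "x \<in> f ` pverts G" "y \<in> f ` pverts G"
      using a V H.in_arcsD1 H.in_arcsD2 unfolding xy by blast+
    then obtain u v where uv: "a = (f u, f v)" "u \<in> pverts G" "v \<in> pverts G"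
      unfolding xy by blast
    then have "(u, v) \<in> parcs G" using f a by blast
    then show "a \<in> map_prod f f ` parcs G" using uv(1) by (intro rev_image_eqI) auto
  next
    fix a assume "a \<in> map_prod f f ` parcs G"
    then obtain u v where uv: "a = (f u, f v)" "(u, v) \<in> parcs G" by auto
    have "u \<in> pverts G" "v \<in> pverts G" using uv(2) G.in_arcsD1 G.in_arcsD2 by blast+
    then show "a \<in> parcs H" using f uv by blast
  qed
  have injA: "inj_on (map_prod f f) (parcs G)"
    using map_prod_inj_on[OF inj inj] by (rule inj_on_subset) (auto dest: G.in_arcsD1 G.in_arcsD2)
  have "pre_digraph.digraph_isomorphism (with_proj G) ?h"
    using inj injA G.wf_digraph by (auto simp: pre_digraph.digraph_isomorphism_def)
  moreover have "with_proj H = app_iso ?h (with_proj G)"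
    using V A by (simp add: app_iso_def with_proj_def)
  ultimately show "graph_iso G H"
    by (auto simp: graph_iso_def digraph_iso_def)
qed

lemma connected_iff_reachable:
  assumes "pair_graph G"
  shows "connected (with_proj G) \<longleftrightarrow>
    pverts G \<noteq> {} \<and> (\<forall>u \<in> pverts G. \<forall>v \<in> pverts G. u \<rightarrow>\<^sup>*\<^bsub>with_proj G\<^esub> v)"
proof -
  interpret pair_graph G by fact
  have sym: "(v, u) \<in> parcs G" if "(u, v) \<in> parcs G" for u v
    using pair_sym_arcs that by (auto simp: symmetric_def dest: symD)
  have "parcs (mk_symmetric (with_proj G)) = parcs G"
    using sym by (auto simp: mk_symmetric_def)
  then have "mk_symmetric (with_proj G) = G"
    by (simp add: mk_symmetric_def)
  then show ?thesis by (simp add: connected_def strongly_connected_def)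
qed

lemma connected_graph_on_star_graph:
  assumes "n \<ge> 1"
  shows "connected_graph_on n (star_graph n)"
proof -
  let ?S = "star_graph n"
  interpret pair_graph ?S
    by unfold_locales (auto simp: star_graph_def symmetric_def sym_def)
  have up: "0 \<rightarrow>\<^sup>*\<^bsub>with_proj ?S\<^esub> v" "v \<rightarrow>\<^sup>*\<^bsub>with_proj ?S\<^esub> 0" if "v < n" for v
  proof -
    have "(0, v) \<in> parcs ?S \<and> (v, 0) \<in> parcs ?S" if "v \<noteq> 0"
      using that \<open>v < n\<close> by (auto simp: star_graph_def)
    moreover have "0 \<in> pverts ?S" using assms by (auto simp: star_graph_def lessThan_empty_iff)
    ultimately show "0 \<rightarrow>\<^sup>*\<^bsub>with_proj ?S\<^esub> v" "v \<rightarrow>\<^sup>*\<^bsub>with_proj ?S\<^esub> 0"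
      by (cases "v = 0"; simp add: reachable_adjI)+
  qed
  have "connected (with_proj ?S)"
    unfolding connected_iff_reachable[OF pair_graph_axioms]
  proof (intro conjI ballI)
    show "pverts ?S \<noteq> {}" using assms by (auto simp: star_graph_def lessThan_empty_iff)
    fix u v assume "u \<in> pverts ?S" "v \<in> pverts ?S"
    then have "u < n" "v < n" by (auto simp: star_graph_def)
    then show "u \<rightarrow>\<^sup>*\<^bsub>with_proj ?S\<^esub> v" by (blast intro: up reachable_trans)
  qed
  then show ?thesis
    unfolding connected_graph_on_def using pair_graph_axioms by (simp add: star_graph_def)
qed

end

theory Submission
  imports Defs
begin

text \<open>
  The engine is a relation between four graphs. Let \<open>vw\<close> be an edge of a graph \<open>E\<close> and let \<open>u\<close>
  be a vertex joined to neither \<open>v\<close> nor \<open>w\<close>. A proper colouring of \<open>E\<close> cannot give \<open>u\<close> the colour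
  of both \<open>v\<close> and \<open>w\<close>, so it is proper for \<open>E + uv\<close> or for \<open>E + uw\<close>, and it is proper for both iff
  it is proper for \<open>E + uv + uw\<close>. Inclusion-exclusion gives the modular relation
  \<open>X(E + uv + uw) + X(E) = X(E + uv) + X(E + uw)\<close>. If \<open>E\<close> is connected, then so are all four graphs,
  and only \<open>E + uv\<close> and \<open>E + uw\<close> have the same number of edges. So the relation expresses \<open>X\<close> of any
  of these graphs through graphs not isomorphic to it; when \<open>E + uv\<close> and \<open>E + uw\<close> happen to be
  isomorphic, it reads \<open>2 X(E + uv) = X(E + uv + uw) + X(E)\<close>, and one divides by two.

  A connected graph \<open>G\<close> on at least four vertices that occurs in no such relation is a star
  (lemma \<open>star_or_in_span\<close>). As \<open>G\<close> is not the graph \<open>E\<close> of a relation, a vertex outside an edge is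
  joined to one of its ends, i.e. \<open>G\<close> is complete multipartite. A triangle, together with a fourth
  vertex, would make \<open>G\<close> an \<open>E + uv + uw\<close>; without triangles, \<open>G\<close> is complete bipartite, and
  if both sides had at least two vertices, then a 4-cycle would make \<open>G\<close> an \<open>E + uv\<close>.

  Conversely, the coefficient of \<open>x\<^sub>1\<^bsup>n-1\<^esup> x\<^sub>2\<close> counts the vertices whose removal leaves an independent
  set. For a connected graph it is nonzero only if the graph is a star, so this coefficient is a
  linear functional that separates \<open>X\<close> of the star from the span of the others.
\<close>

section \<open>Graphs, isomorphism and colourings\<close>

lemma pair_graph_iff:
  "pair_graph G \<longleftrightarrow>
     finite (pverts G) \<and> parcs G \<subseteq> pverts G \<times> pverts G \<and> irrefl (parcs G) \<and> sym (parcs G)"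
proof
  assume "pair_graph G"
  then interpret pair_graph G .
  show "finite (pverts G) \<and> parcs G \<subseteq> pverts G \<times> pverts G \<and> irrefl (parcs G) \<and> sym (parcs G)"
    using pair_finite_verts in_arcsD1 in_arcsD2 pair_no_loops pair_sym_arcs
    by (force simp: irrefl_def symmetric_def)
next
  assume *: "finite (pverts G) \<and> parcs G \<subseteq> pverts G \<times> pverts G \<and> irrefl (parcs G) \<and> sym (parcs G)"
  then have "finite (parcs G)"
    by (meson finite_SigmaI finite_subset)
  with * show "pair_graph G"
    by unfold_locales (auto simp: symmetric_def irrefl_def)
qed

lemma connected_graph_on_iff:
  "connected_graph_on n G \<longleftrightarrow>
     pair_graph G \<and> card (pverts G) = n \<and> pverts G \<noteq> {} \<and>
     (\<forall>u \<in> pverts G. \<forall>v \<in> pverts G. (u, v) \<in> (parcs G)\<^sup>*)"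
proof (cases "pair_graph G")
  case True
  then interpret pair_graph G .
  show ?thesis
    unfolding connected_graph_on_def using True
    by (auto simp: connected_iff_reachable reachable_conv)
qed (simp add: connected_graph_on_def)

lemma connected_graph_onD:
  assumes "connected_graph_on n G"
  shows "pair_graph G" "finite (pverts G)" "card (pverts G) = n" "finite (parcs G)"
    and "\<And>x y. (x, y) \<in> parcs G \<Longrightarrow> (y, x) \<in> parcs G"
    and "\<And>x y. (x, y) \<in> parcs G \<Longrightarrow> x \<in> pverts G"
    and "\<And>x y. (x, y) \<in> parcs G \<Longrightarrow> y \<in> pverts G"
    and "\<And>x. (x, x) \<notin> parcs G"
proof -
  show "pair_graph G" "card (pverts G) = n"
    using assms by (auto simp: connected_graph_on_def)
  then have *: "finite (pverts G)" "parcs G \<subseteq> pverts G \<times> pverts G" "irrefl (parcs G)" "sym (parcs G)"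
    by (auto simp: pair_graph_iff)
  then show "finite (pverts G)" "finite (parcs G)"
    by (auto intro: finite_subset)
  show "\<And>x y. (x, y) \<in> parcs G \<Longrightarrow> (y, x) \<in> parcs G"
    "\<And>x y. (x, y) \<in> parcs G \<Longrightarrow> x \<in> pverts G"
    "\<And>x y. (x, y) \<in> parcs G \<Longrightarrow> y \<in> pverts G"
    "\<And>x. (x, x) \<notin> parcs G"
    using * by (auto simp: irrefl_def dest: symD)
qed

lemma connected_graph_on_neighbour:
  assumes "connected_graph_on n G" "n \<ge> 2" "u \<in> pverts G"
  obtains v where "(u, v) \<in> parcs G"
proof -
  have "pverts G \<noteq> {u}"
    using connected_graph_onD(3)[OF assms(1)] assms(2) by auto
  then obtain w where w: "w \<in> pverts G" "w \<noteq> u"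
    using assms(3) by blast
  then have "(u, w) \<in> (parcs G)\<^sup>*"
    using assms by (auto simp: connected_graph_on_iff)
  then show thesis
    using w(2) that by (metis converse_rtranclE)
qed

lemma graph_iso_sym:
  assumes "pair_graph G" "pair_graph H" "graph_iso G H"
  shows "graph_iso H G"
proof -
  obtain f where f: "bij_betw f (pverts G) (pverts H)"
    "\<And>u v. u \<in> pverts G \<Longrightarrow> v \<in> pverts G \<Longrightarrow> (u, v) \<in> parcs G \<longleftrightarrow> (f u, f v) \<in> parcs H"
    using assms by (auto simp: graph_iso_iff)
  let ?g = "inv_into (pverts G) f"
  have "bij_betw ?g (pverts H) (pverts G)"
    using f(1) by (rule bij_betw_inv_into)
  moreover have "(u, v) \<in> parcs H \<longleftrightarrow> (?g u, ?g v) \<in> parcs G"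
    if "u \<in> pverts H" "v \<in> pverts H" for u v
    using that f(2)[of "?g u" "?g v"] f(1) calculation
    by (simp add: bij_betw_inv_into_right bij_betwE)
  ultimately show ?thesis
    using assms by (auto simp: graph_iso_iff)
qed

lemma graph_iso_trans:
  assumes "pair_graph G" "pair_graph H" "pair_graph K" "graph_iso G H" "graph_iso H K"
  shows "graph_iso G K"
proof -
  obtain f where f: "bij_betw f (pverts G) (pverts H)"
    "\<And>u v. u \<in> pverts G \<Longrightarrow> v \<in> pverts G \<Longrightarrow> (u, v) \<in> parcs G \<longleftrightarrow> (f u, f v) \<in> parcs H"
    using assms(1,2,4) by (auto simp: graph_iso_iff)
  obtain g where g: "bij_betw g (pverts H) (pverts K)"
    "\<And>u v. u \<in> pverts H \<Longrightarrow> v \<in> pverts H \<Longrightarrow> (u, v) \<in> parcs H \<longleftrightarrow> (g u, g v) \<in> parcs K"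
    using assms(2,3,5) by (auto simp: graph_iso_iff)
  have "bij_betw (g \<circ> f) (pverts G) (pverts K)"
    using f(1) g(1) by (rule bij_betw_trans)
  moreover have "(u, v) \<in> parcs G \<longleftrightarrow> ((g \<circ> f) u, (g \<circ> f) v) \<in> parcs K"
    if "u \<in> pverts G" "v \<in> pverts G" for u v
    using that f g(2) by (simp add: bij_betwE)
  ultimately show ?thesis
    unfolding graph_iso_iff[OF assms(1,3)] by blast
qed

lemma graph_iso_card_parcs:
  assumes "pair_graph G" "pair_graph H" "graph_iso G H"
  shows "card (parcs G) = card (parcs H)"
proof -
  have le: "card (parcs G) \<le> card (parcs H)"
    if G: "pair_graph G" and H: "pair_graph H" and iso: "graph_iso G H"
    for G :: "'c pair_pre_digraph" and H :: "'d pair_pre_digraph"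
  proof -
    obtain f where f: "bij_betw f (pverts G) (pverts H)"
      "\<And>u v. u \<in> pverts G \<Longrightarrow> v \<in> pverts G \<Longrightarrow> (u, v) \<in> parcs G \<longleftrightarrow> (f u, f v) \<in> parcs H"
      using G H iso by (auto simp: graph_iso_iff)
    have sub: "parcs G \<subseteq> pverts G \<times> pverts G"
      using G by (simp add: pair_graph_iff)
    have "inj_on f (pverts G)"
      using f(1) by (rule bij_betw_imp_inj_on)
    then have "inj_on (map_prod f f) (parcs G)"
      using sub by (blast intro: inj_on_subset map_prod_inj_on)
    moreover have "map_prod f f ` parcs G \<subseteq> parcs H"
      using f(2) sub by auto
    moreover have "finite (parcs H)"
      using H unfolding pair_graph_iff by (meson finite_SigmaI finite_subset)
    ultimately show ?thesis
      by (rule card_inj_on_le)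
  qed
  show ?thesis
    using le[OF assms] le[OF assms(2,1) graph_iso_sym[OF assms]] by (rule antisym)
qed

lemma graph_iso_chromatic_symmetric_function:
  assumes "pair_graph G" "pair_graph H" "graph_iso G H"
  shows "chromatic_symmetric_function G = chromatic_symmetric_function H"
proof -
  have le: "card {\<kappa> \<in> proper_colourings H. colouring_monomial H \<kappa> = m}
      \<le> card {\<kappa> \<in> proper_colourings G. colouring_monomial G \<kappa> = m}" (is "card ?H \<le> card ?G")
    if G: "pair_graph G" and H: "pair_graph H" and iso: "graph_iso G H"
    for G :: "'c pair_pre_digraph" and H :: "'d pair_pre_digraph" and m
  proof -
    obtain f where f: "bij_betw f (pverts G) (pverts H)"
      "\<And>u v. u \<in> pverts G \<Longrightarrow> v \<in> pverts G \<Longrightarrow> (u, v) \<in> parcs G \<longleftrightarrow> (f u, f v) \<in> parcs H"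
      using G H iso by (auto simp: graph_iso_iff)
    have sub: "parcs G \<subseteq> pverts G \<times> pverts G"
      using G by (simp add: pair_graph_iff)
    let ?p = "\<lambda>\<kappa>. restrict (\<kappa> \<circ> f) (pverts G)"
    have "inj_on ?p ?H"
    proof (rule inj_onI)
      fix \<kappa> \<kappa>' assume k: "\<kappa> \<in> ?H" "\<kappa>' \<in> ?H" and eq: "?p \<kappa> = ?p \<kappa>'"
      have ext: "\<kappa> \<in> extensional (pverts H)" "\<kappa>' \<in> extensional (pverts H)"
        using k by (auto simp: proper_colourings_def PiE_def)
      show "\<kappa> = \<kappa>'"
      proof (rule extensionalityI[OF ext])
        fix y assume "y \<in> pverts H"
        then obtain x where "x \<in> pverts G" "y = f x"
          using f(1) by (auto simp: bij_betw_def)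
        then show "\<kappa> y = \<kappa>' y"
          using fun_cong[OF eq, of x] by simp
      qed
    qed
    moreover have "?p ` ?H \<subseteq> ?G"
    proof (rule image_subsetI)
      fix \<kappa> assume k: "\<kappa> \<in> ?H"
      have "colouring_monomial G (?p \<kappa>) = image_mset (\<kappa> \<circ> f) (mset_set (pverts G))"
        using G unfolding colouring_monomial_def pair_graph_iff
        by (intro image_mset_cong) auto
      also have "\<dots> = image_mset \<kappa> (mset_set (f ` pverts G))"
        using f(1) by (simp add: image_mset_mset_set bij_betw_imp_inj_on flip: multiset.map_comp)
      also have "\<dots> = m"
        using k f(1) by (simp add: colouring_monomial_def bij_betw_def)
      finally have "colouring_monomial G (?p \<kappa>) = m" .
      moreover have "?p \<kappa> \<in> proper_colourings G"
        unfolding proper_colourings_def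
      proof (intro CollectI conjI ballI)
        show "?p \<kappa> \<in> pverts G \<rightarrow>\<^sub>E {1..}"
          using k bij_betwE[OF f(1)] by (auto simp: proper_colourings_def PiE_iff)
      next
        fix a assume "a \<in> parcs G"
        then obtain x y where a: "a = (x, y)" "x \<in> pverts G" "y \<in> pverts G" "(f x, f y) \<in> parcs H"
          using sub f(2) by (cases a) blast
        then show "case a of (x, y) \<Rightarrow> ?p \<kappa> x \<noteq> ?p \<kappa> y"
          using k by (auto simp: proper_colourings_def)
      qed
      ultimately show "?p \<kappa> \<in> ?G" by simp
    qed
    moreover have "finite ?G"
      using G by (intro finite_colourings_of_monomial) (simp add: pair_graph_iff)
    ultimately show ?thesis
      by (rule card_inj_on_le)
  qed
  show ?thesis
    unfolding chromatic_symmetric_function_def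
    using le[OF assms] le[OF assms(2,1) graph_iso_sym[OF assms]]
    by (simp add: fun_eq_iff antisym)
qed

lemma ex_isomorphic_nat_graph:
  assumes "connected_graph_on n G"
  obtains H :: "nat pair_pre_digraph" where "connected_graph_on n H" "graph_iso G H"
proof -
  note G = connected_graph_onD[OF assms]
  obtain f :: "'a \<Rightarrow> nat" where f: "bij_betw f (pverts G) {0..<card (pverts G)}"
    using G(2) ex_bij_betw_finite_nat by blast
  then have inj: "inj_on f (pverts G)"
    by (simp add: bij_betw_def)
  let ?H = "\<lparr> pverts = f ` pverts G, parcs = map_prod f f ` parcs G \<rparr>"
  have H: "pair_graph ?H"
    unfolding pair_graph_iff
  proof (intro conjI)
    show "irrefl (parcs ?H)"
      using G inj by (auto simp: irrefl_def dest!: inj_onD)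
    show "sym (parcs ?H)"
      using G(5) by (auto simp: sym_def intro: rev_image_eqI)
  qed (use G in auto)
  have "(f u, f v) \<in> (parcs ?H)\<^sup>*" if "(u, v) \<in> (parcs G)\<^sup>*" for u v
    using that
  proof induction
    case (step v w)
    then have "(f v, f w) \<in> parcs ?H"
      by (auto intro: rev_image_eqI)
    with step.IH show ?case
      by (rule rtrancl_into_rtrancl)
  qed simp
  then have "connected_graph_on n ?H"
    using assms H inj unfolding connected_graph_on_iff by (auto simp: card_image)
  moreover have "(u, v) \<in> parcs G \<longleftrightarrow> (f u, f v) \<in> parcs ?H"
    if "u \<in> pverts G" "v \<in> pverts G" for u v
  proof
    assume "(f u, f v) \<in> parcs ?H"
    then obtain x y where xy: "(x, y) \<in> parcs G" "f u = f x" "f v = f y"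
      by auto
    then have "x = u" "y = v"
      using that G(6,7)[OF xy(1)] inj by (auto dest: inj_onD)
    with xy(1) show "(u, v) \<in> parcs G"
      by simp
  qed (auto intro: rev_image_eqI)
  then have "graph_iso G ?H"
    using inj unfolding graph_iso_iff[OF G(1) H] by (auto intro!: exI[of _ f] simp: bij_betw_def)
  ultimately show thesis by (rule that)
qed

section \<open>The modular relation\<close>

definition add_edge :: "'a pair_pre_digraph \<Rightarrow> 'a \<Rightarrow> 'a \<Rightarrow> 'a pair_pre_digraph" where
  "add_edge G u v = G\<lparr> parcs := {(u, v), (v, u)} \<union> parcs G \<rparr>"

definition del_edge :: "'a pair_pre_digraph \<Rightarrow> 'a \<Rightarrow> 'a \<Rightarrow> 'a pair_pre_digraph" where
  "del_edge G u v = G\<lparr> parcs := parcs G - {(u, v), (v, u)} \<rparr>"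

lemma add_edge_simps [simp]:
  "pverts (add_edge G u v) = pverts G"
  "parcs (add_edge G u v) = {(u, v), (v, u)} \<union> parcs G"
  by (simp_all add: add_edge_def)

lemma del_edge_simps [simp]:
  "pverts (del_edge G u v) = pverts G"
  "parcs (del_edge G u v) = parcs G - {(u, v), (v, u)}"
  by (simp_all add: del_edge_def)

lemma add_edge_del_edge:
  assumes "(u, v) \<in> parcs G" "(v, u) \<in> parcs G"
  shows "add_edge (del_edge G u v) u v = G"
proof -
  have "{(u, v), (v, u)} \<union> (parcs G - {(u, v), (v, u)}) = parcs G"
    using assms by blast
  then show ?thesis
    by (simp add: add_edge_def del_edge_def)
qed

lemma connected_graph_on_add_edge:
  assumes "connected_graph_on n G" "u \<in> pverts G" "v \<in> pverts G" "u \<noteq> v"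
  shows "connected_graph_on n (add_edge G u v)"
proof -
  have "(parcs G)\<^sup>* \<subseteq> (parcs (add_edge G u v))\<^sup>*"
    by (rule rtrancl_mono) auto
  moreover have "pair_graph (add_edge G u v)"
    unfolding pair_graph_iff
  proof (intro conjI)
    show "sym (parcs (add_edge G u v))"
    proof (rule symI)
      fix x y assume "(x, y) \<in> parcs (add_edge G u v)"
      then show "(y, x) \<in> parcs (add_edge G u v)"
        using connected_graph_onD(5)[OF assms(1), of x y] by auto
    qed
  qed (use assms(2-4) connected_graph_onD(2,6-8)[OF assms(1)] in \<open>auto simp: irrefl_def\<close>)
  ultimately show ?thesis
    using assms(1) unfolding connected_graph_on_iff add_edge_simps(1) by blast
qed

lemma connected_graph_on_del_edge:
  assumes G: "connected_graph_on n G" and uv: "(u, v) \<in> (parcs (del_edge G u v))\<^sup>*"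
  shows "connected_graph_on n (del_edge G u v)"
proof -
  have sym: "sym (parcs (del_edge G u v))"
  proof (rule symI)
    fix x y assume "(x, y) \<in> parcs (del_edge G u v)"
    then show "(y, x) \<in> parcs (del_edge G u v)"
      using connected_graph_onD(5)[OF G, of x y] by auto
  qed
  then have "(v, u) \<in> (parcs (del_edge G u v))\<^sup>*"
    using uv by (blast dest: sym_rtrancl symD)
  then have "{(u, v), (v, u)} \<union> parcs (del_edge G u v) \<subseteq> (parcs (del_edge G u v))\<^sup>*"
    using uv by blast
  then have "parcs G \<subseteq> (parcs (del_edge G u v))\<^sup>*"
    unfolding del_edge_simps(2) by blast
  then have "(parcs G)\<^sup>* \<subseteq> (parcs (del_edge G u v))\<^sup>*"
    by (rule rtrancl_subset_rtrancl)
  moreover have "pair_graph (del_edge G u v)"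
    unfolding pair_graph_iff
    by (intro conjI sym) (use connected_graph_onD(2,6-8)[OF G] in \<open>auto simp: irrefl_def\<close>)
  ultimately show ?thesis
    using G unfolding connected_graph_on_iff del_edge_simps(1) by blast
qed

lemma card_parcs_add_edge:
  assumes "connected_graph_on n G" "(u, v) \<notin> parcs G" "u \<noteq> v"
  shows "card (parcs (add_edge G u v)) = card (parcs G) + 2"
proof -
  have "(v, u) \<notin> parcs G"
    using assms(2) connected_graph_onD(5)[OF assms(1), of v u] by blast
  then show ?thesis
    using assms(2,3) connected_graph_onD(4)[OF assms(1)] by simp
qed

lemma proper_colourings_add_edge:
  "proper_colourings (add_edge G u v) = {\<kappa> \<in> proper_colourings G. \<kappa> u \<noteq> \<kappa> v}"
proof -
  have "(\<forall>(x, y) \<in> parcs (add_edge G u v). \<kappa> x \<noteq> \<kappa> y) \<longleftrightarrow>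
      (\<forall>(x, y) \<in> parcs G. \<kappa> x \<noteq> \<kappa> y) \<and> \<kappa> u \<noteq> \<kappa> v" for \<kappa> :: "'a \<Rightarrow> nat"
    unfolding add_edge_simps(2) ball_Un by auto
  then show ?thesis
    unfolding proper_colourings_def add_edge_simps(1) by blast
qed

lemma colouring_monomial_add_edge: "colouring_monomial (add_edge G u v) = colouring_monomial G"
  by (simp add: colouring_monomial_def fun_eq_iff)

text \<open>
  Inclusion-exclusion over the proper colourings of \<open>G\<close>: none of them gives \<open>u\<close> the colour of
  both ends of \<open>vw\<close>.
\<close>

lemma chromatic_modular_relation:
  assumes "finite (pverts G)" "(v, w) \<in> parcs G"
  shows "chromatic_symmetric_function (add_edge (add_edge G u v) u w) + chromatic_symmetric_function G =
    chromatic_symmetric_function (add_edge G u v) + chromatic_symmetric_function (add_edge G u w)"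
proof
  fix m
  define C where "C K = {\<kappa> \<in> proper_colourings K. colouring_monomial K \<kappa> = m}"
    for K :: "'a pair_pre_digraph"
  have fin: "finite (C (add_edge G x y))" for x y
    unfolding C_def using assms(1) by (intro finite_colourings_of_monomial) simp
  have C_add_edge: "C (add_edge K x y) = {\<kappa> \<in> C K. \<kappa> x \<noteq> \<kappa> y}" for K x y
    unfolding C_def proper_colourings_add_edge colouring_monomial_add_edge by blast
  have "\<kappa> v \<noteq> \<kappa> w" if "\<kappa> \<in> C G" for \<kappa>
    using that assms(2) by (auto simp: C_def proper_colourings_def)
  then have union: "C (add_edge G u v) \<union> C (add_edge G u w) = C G"
    unfolding C_add_edge by fastforce
  have inter: "C (add_edge G u v) \<inter> C (add_edge G u w) = C (add_edge (add_edge G u v) u w)"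
    unfolding C_add_edge by blast
  have "card (C (add_edge (add_edge G u v) u w)) + card (C G) =
      card (C (add_edge G u v)) + card (C (add_edge G u w))"
    using card_Un_Int[OF fin fin, of u v u w] unfolding union inter by linarith
  then have "(of_nat (card (C (add_edge (add_edge G u v) u w)) + card (C G)) :: rat) =
      of_nat (card (C (add_edge G u v)) + card (C (add_edge G u w)))"
    by (simp only:)
  then show "(chromatic_symmetric_function (add_edge (add_edge G u v) u w)
        + chromatic_symmetric_function G) m =
      (chromatic_symmetric_function (add_edge G u v) + chromatic_symmetric_function (add_edge G u w)) m"
    unfolding chromatic_symmetric_function_def plus_fun_def C_def of_nat_add .
qed

section \<open>Consequences for the span\<close>

definition non_isomorphic_span :: "nat \<Rightarrow> 'a pair_pre_digraph \<Rightarrow> power_series set" where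
  "non_isomorphic_span n G = series.span {chromatic_symmetric_function H | H :: nat pair_pre_digraph.
     connected_graph_on n H \<and> \<not> graph_iso G H}"

text \<open>
  The spanning set only mentions graphs on natural numbers; this lemma allows graphs on the
  vertices of \<open>G\<close> itself.
\<close>

lemma in_non_isomorphic_span:
  fixes G :: "'a pair_pre_digraph" and H :: "'b pair_pre_digraph"
  assumes G: "connected_graph_on n G" and H: "connected_graph_on n H" and "\<not> graph_iso G H"
  shows "chromatic_symmetric_function H \<in> non_isomorphic_span n G"
proof -
  obtain K :: "nat pair_pre_digraph" where K: "connected_graph_on n K" "graph_iso H K"
    using H by (rule ex_isomorphic_nat_graph)
  note pg = connected_graph_onD(1)[OF G] connected_graph_onD(1)[OF H] connected_graph_onD(1)[OF K(1)]
  have "\<not> graph_iso G K"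
    using assms(3) graph_iso_trans[OF pg(1,3,2)] graph_iso_sym[OF pg(2,3) K(2)] by blast
  moreover have "chromatic_symmetric_function H = chromatic_symmetric_function K"
    using pg(2,3) K(2) by (rule graph_iso_chromatic_symmetric_function)
  ultimately show ?thesis
    unfolding non_isomorphic_span_def using K(1) by (auto intro: series.span_base)
qed

text \<open>
  In the case \<open>G = E + uv\<close>, the graph \<open>E + uw\<close> may be isomorphic to \<open>G\<close>; then \<open>X(G)\<close> occurs twice
  in the relation. The other graphs involved are told apart by their numbers of edges. The case
  \<open>G = E + uw\<close> is the same up to exchanging \<open>v\<close> and \<open>w\<close>.
\<close>

lemma modular_relation_in_span:
  assumes E: "connected_graph_on n E" and vw: "(v, w) \<in> parcs E"
    and u: "u \<in> pverts E" "u \<noteq> v" "u \<noteq> w" "(u, v) \<notin> parcs E" "(u, w) \<notin> parcs E"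
    and G: "G = E \<or> G = add_edge E u v \<or> G = add_edge (add_edge E u v) u w"
  shows "chromatic_symmetric_function G \<in> non_isomorphic_span n G"
proof -
  let ?X = "chromatic_symmetric_function"
  let ?E1 = "add_edge E u v" and ?E2 = "add_edge E u w"
  let ?E12 = "add_edge ?E1 u w"
  note D = connected_graph_onD[OF E]
  have ends: "v \<in> pverts E" "w \<in> pverts E" "v \<noteq> w"
    using D(6)[OF vw] D(7)[OF vw] D(8)[of v] vw by auto
  have conn: "connected_graph_on n ?E1" "connected_graph_on n ?E2" "connected_graph_on n ?E12"
    using E u ends by (simp_all add: connected_graph_on_add_edge)
  then have Gc: "connected_graph_on n G"
    using G E by auto
  have card: "card (parcs ?E1) = card (parcs E) + 2" "card (parcs ?E2) = card (parcs E) + 2"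
    using card_parcs_add_edge[OF E] u by blast+
  have card12: "card (parcs ?E12) = card (parcs E) + 4"
  proof -
    have "(u, w) \<notin> parcs ?E1"
      using u ends by auto
    from card_parcs_add_edge[OF conn(1) this u(3)] card(1) show ?thesis
      by linarith
  qed
  have in_span: "?X H \<in> non_isomorphic_span n G"
    if "connected_graph_on n H" "card (parcs H) \<noteq> card (parcs G)" for H :: "'a pair_pre_digraph"
    using in_non_isomorphic_span[OF Gc that(1)] that(2)
      graph_iso_card_parcs[OF connected_graph_onD(1)[OF Gc] connected_graph_onD(1)[OF that(1)]]
    by auto
  have rel: "?X ?E12 + ?X E = ?X ?E1 + ?X ?E2"
    using D(2) vw by (rule chromatic_modular_relation)
  consider "G = E" | "G = ?E12" | "G = ?E1"
    using G by blast
  then show ?thesis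
  proof cases
    case 1
    have "?X E = ?X ?E1 + ?X ?E2 - ?X ?E12"
      using rel by (simp add: algebra_simps)
    moreover have "?X ?E1 + ?X ?E2 - ?X ?E12 \<in> non_isomorphic_span n G"
      using in_span[OF conn(1)] in_span[OF conn(2)] in_span[OF conn(3)] card card12 1
      unfolding non_isomorphic_span_def by (intro series.span_diff series.span_add) (simp_all del: add_edge_simps)
    ultimately show ?thesis
      using 1 by simp
  next
    case 2
    have "?X ?E12 = ?X ?E1 + ?X ?E2 - ?X E"
      using rel by (simp add: algebra_simps)
    moreover have "?X ?E1 + ?X ?E2 - ?X E \<in> non_isomorphic_span n G"
      using in_span[OF conn(1)] in_span[OF conn(2)] in_span[OF E] card card12 2
      unfolding non_isomorphic_span_def by (intro series.span_diff series.span_add) (simp_all del: add_edge_simps)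
    ultimately show ?thesis
      using 2 by simp
  next
    case 3
    have outer: "?X ?E12 + ?X E \<in> non_isomorphic_span n G"
      using in_span[OF conn(3)] in_span[OF E] card card12 3
      unfolding non_isomorphic_span_def by (intro series.span_add) (simp_all del: add_edge_simps)
    show ?thesis
    proof (cases "graph_iso G ?E2")
      case True
      then have "?X ?E2 = ?X G"
        using graph_iso_chromatic_symmetric_function Gc conn(2) connected_graph_onD(1) by metis
      then have "?X ?E12 + ?X E = ?X G + ?X G"
        using rel 3 by simp
      then have "?X G = series_scale (1/2) (?X ?E12 + ?X E)"
        by (simp add: series_scale_def fun_eq_iff)
      moreover have "series_scale (1/2) (?X ?E12 + ?X E) \<in> non_isomorphic_span n G"
        using outer unfolding non_isomorphic_span_def by (rule series.span_scale)
      ultimately show ?thesis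
        by (simp only:)
    next
      case False
      then have "?X ?E2 \<in> non_isomorphic_span n G"
        using Gc conn(2) by (intro in_non_isomorphic_span)
      then have "(?X ?E12 + ?X E) - ?X ?E2 \<in> non_isomorphic_span n G"
        using outer unfolding non_isomorphic_span_def by (intro series.span_diff)
      moreover have "?X G = (?X ?E12 + ?X E) - ?X ?E2"
        using rel 3 by (simp add: algebra_simps)
      ultimately show ?thesis
        by (simp only:)
    qed
  qed
qed

section \<open>Stars\<close>

lemma graph_iso_star_graphI:
  assumes G: "connected_graph_on n G" and c: "c \<in> pverts G"
    and adj: "\<And>v. v \<in> pverts G \<Longrightarrow> v \<noteq> c \<Longrightarrow> (c, v) \<in> parcs G"
    and indep: "\<And>u v. u \<noteq> c \<Longrightarrow> v \<noteq> c \<Longrightarrow> (u, v) \<notin> parcs G"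
  shows "graph_iso G (star_graph n)"
proof -
  note D = connected_graph_onD[OF G]
  have "card (pverts G) \<noteq> 0"
    using D(2) c by auto
  then have n: "n \<ge> 1"
    using D(3) by linarith
  have "card (pverts G - {c}) = card {1..<n}"
    using D(2,3) c by simp
  then obtain f where f: "bij_betw f (pverts G - {c}) {1..<n}"
    using D(2) by (metis finite_Diff finite_atLeastLessThan finite_same_card_bij)
  let ?f = "f(c := 0)"
  have "bij_betw ?f (pverts G - {c}) {1..<n}"
    using f bij_betw_cong[of "pverts G - {c}" f ?f "{1..<n}"] by simp
  moreover have "bij_betw ?f {c} {0}"
    by (simp add: bij_betw_def)
  ultimately have "bij_betw ?f ((pverts G - {c}) \<union> {c}) ({1..<n} \<union> {0})"
    by (rule bij_betw_combine) simp
  moreover have "(pverts G - {c}) \<union> {c} = pverts G" "{1..<n} \<union> {0} = {..<n}"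
    using c n by auto
  ultimately have bij: "bij_betw ?f (pverts G) {..<n}"
    by (simp only:)
  have range: "f v \<in> {1..<n}" if "v \<in> pverts G" "v \<noteq> c" for v
    using f that by (auto dest: bij_betwE)
  have "(u, v) \<in> parcs G \<longleftrightarrow> (?f u, ?f v) \<in> parcs (star_graph n)"
    if "u \<in> pverts G" "v \<in> pverts G" for u v
    using that adj[of u] adj[of v] indep[of u v] range[of u] range[of v] D(5)[of c u] D(8)[of c]
    by (cases "u = c"; cases "v = c") (auto simp: star_graph_def)
  then show ?thesis
    unfolding graph_iso_iff[OF D(1) connected_graph_onD(1)[OF connected_graph_on_star_graph[OF n]]]
    using bij by (intro exI[of _ ?f] conjI ballI) (simp_all add: star_graph_def)
qed

text \<open>The exponent vector of \<open>x\<^sub>1\<^bsup>n-1\<^esup> x\<^sub>2\<close>.\<close>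

definition star_monomial :: "nat \<Rightarrow> nat multiset" where
  "star_monomial n = add_mset 2 (replicate_mset (n - 1) 1)"

text \<open>
  In a colouring with this monomial, all vertices but one share a colour, hence are independent;
  by connectedness each of them is joined to the remaining vertex.
\<close>

lemma star_if_star_monomial:
  assumes G: "connected_graph_on n G" and n: "n \<ge> 2"
    and nz: "chromatic_symmetric_function G (star_monomial n) \<noteq> 0"
  shows "graph_iso G (star_graph n)"
proof -
  note D = connected_graph_onD[OF G]
  have "{\<kappa> \<in> proper_colourings G. colouring_monomial G \<kappa> = star_monomial n} \<noteq> {}"
    using nz unfolding chromatic_symmetric_function_def by (metis card.empty of_nat_0)
  then obtain \<kappa> where k: "\<kappa> \<in> proper_colourings G"
    and m: "image_mset \<kappa> (mset_set (pverts G)) = add_mset 2 (replicate_mset (n - 1) 1)"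
    by (auto simp: colouring_monomial_def star_monomial_def)
  then obtain A c where A: "mset_set (pverts G) = add_mset c A" "\<kappa> c = 2"
    "image_mset \<kappa> A = replicate_mset (n - 1) 1"
    using msed_map_invR by metis
  have c: "c \<in> pverts G"
    using elem_mset_set[OF D(2), of c] unfolding A(1) by simp
  have one: "\<kappa> v = 1" if "v \<in> pverts G" "v \<noteq> c" for v
  proof -
    have "v \<in># A"
      using elem_mset_set[OF D(2), of v] that unfolding A(1) by simp
    then have "\<kappa> v \<in># replicate_mset (n - 1) 1"
      unfolding A(3)[symmetric] by simp
    then show ?thesis
      by (meson in_replicate_mset)
  qed
  have indep: "(u, v) \<notin> parcs G" if "u \<noteq> c" "v \<noteq> c" for u v
    using that k one[of u] one[of v] D(6,7)[of u v] by (auto simp: proper_colourings_def)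
  have "(c, v) \<in> parcs G" if v: "v \<in> pverts G" "v \<noteq> c" for v
  proof -
    obtain w where "(v, w) \<in> parcs G"
      using G n v(1) by (rule connected_graph_on_neighbour)
    then show ?thesis
      using indep[OF v(2)] D(5) by metis
  qed
  then show ?thesis
    using G c indep by (intro graph_iso_star_graphI)
qed

lemma star_graph_star_monomial:
  assumes "n \<ge> 1"
  shows "chromatic_symmetric_function (star_graph n) (star_monomial n) \<noteq> 0"
proof -
  let ?C = "{\<kappa> \<in> proper_colourings (star_graph n).
    colouring_monomial (star_graph n) \<kappa> = star_monomial n}"
  let ?\<kappa> = "restrict (\<lambda>v. if v = 0 then 2 else 1 :: nat) {..<n}"
  have split: "{..<n} = insert 0 {1..<n}"
    using assms by auto
  have "image_mset ?\<kappa> (mset_set {1..<n}) = image_mset (\<lambda>_. 1) (mset_set {1..<n})"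
    by (intro image_mset_cong) auto
  then have "colouring_monomial (star_graph n) ?\<kappa> = star_monomial n"
    using assms by (simp add: colouring_monomial_def star_graph_def star_monomial_def split
        image_mset_const_eq)
  moreover have "?\<kappa> \<in> proper_colourings (star_graph n)"
    by (auto simp: proper_colourings_def star_graph_def)
  ultimately have "?\<kappa> \<in> ?C"
    by blast
  moreover have "finite ?C"
    by (intro finite_colourings_of_monomial) (simp add: star_graph_def)
  ultimately have "card ?C \<noteq> 0"
    by auto
  then show ?thesis
    by (simp add: chromatic_symmetric_function_def)
qed

lemma star_not_in_span:
  assumes G: "connected_graph_on n G" and n: "n \<ge> 2" and star: "graph_iso G (star_graph n)"
  shows "chromatic_symmetric_function G \<notin> non_isomorphic_span n G"
proof
  have S: "pair_graph (star_graph n)"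
    using n by (intro connected_graph_onD(1)[OF connected_graph_on_star_graph]) simp
  let ?Z = "{F :: power_series. F (star_monomial n) = 0}"
  have "non_isomorphic_span n G \<subseteq> ?Z"
    unfolding non_isomorphic_span_def
  proof (rule series.span_minimal)
    show "series.subspace ?Z"
      by (rule series.subspaceI) (auto simp: series_scale_def)
  next
    have "chromatic_symmetric_function H (star_monomial n) = 0"
      if H: "connected_graph_on n H" "\<not> graph_iso G H" for H :: "nat pair_pre_digraph"
    proof (rule ccontr)
      assume "chromatic_symmetric_function H (star_monomial n) \<noteq> 0"
      then have "graph_iso H (star_graph n)"
        using H(1) n by (intro star_if_star_monomial)
      then have "graph_iso G H"
        using G H(1) S star by (meson connected_graph_onD(1) graph_iso_sym graph_iso_trans)
      then show False
        using H(2) by blast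
    qed
    then show "{chromatic_symmetric_function H | H :: nat pair_pre_digraph.
        connected_graph_on n H \<and> \<not> graph_iso G H} \<subseteq> ?Z"
      by blast
  qed
  moreover assume "chromatic_symmetric_function G \<in> non_isomorphic_span n G"
  ultimately have "chromatic_symmetric_function G (star_monomial n) = 0"
    by blast
  then show False
    using graph_iso_chromatic_symmetric_function[OF connected_graph_onD(1)[OF G] S star]
      star_graph_star_monomial[of n] n by simp
qed

section \<open>Graphs other than stars\<close>

text \<open>
  The next two lemmas exhibit \<open>G\<close> as \<open>E + uv + uw\<close> and as \<open>E + uv\<close> in a modular relation. The graph
  \<open>E\<close> obtained by deleting edges has to be connected: a detour between the ends of the deleted
  edges leads through \<open>d\<close> in the first lemma and through \<open>x\<close> in the second.
\<close>

lemma diamond_in_span: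
  assumes G: "connected_graph_on n G"
    and tri: "(a, b) \<in> parcs G" "(a, c) \<in> parcs G" "(b, c) \<in> parcs G"
    and d: "(d, a) \<in> parcs G" "(d, b) \<in> parcs G" "d \<noteq> c"
  shows "chromatic_symmetric_function G \<in> non_isomorphic_span n G"
proof -
  note D = connected_graph_onD[OF G]
  have neq: "a \<noteq> b" "a \<noteq> c" "b \<noteq> c" "d \<noteq> a" "d \<noteq> b"
    using tri d D(8) by auto
  let ?F = "del_edge G a c"
  let ?E = "del_edge ?F a b"
  have arcs: "(a, d) \<in> parcs ?E" "(d, b) \<in> parcs ?E" "(b, c) \<in> parcs ?E"
    using tri d neq D(5)[OF d(1)] by auto
  then have E_ab: "(a, b) \<in> (parcs ?E)\<^sup>*" and E_ac: "(a, c) \<in> (parcs ?E)\<^sup>*"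
    by (meson converse_rtrancl_into_rtrancl r_into_rtrancl)+
  have "(parcs ?E)\<^sup>* \<subseteq> (parcs ?F)\<^sup>*"
    by (rule rtrancl_mono) auto
  then have "(a, c) \<in> (parcs ?F)\<^sup>*"
    using E_ac by blast
  with G have "connected_graph_on n ?F"
    by (rule connected_graph_on_del_edge)
  then have E: "connected_graph_on n ?E"
    using E_ab by (rule connected_graph_on_del_edge)
  have "add_edge ?E a b = ?F"
    using tri neq D(5)[OF tri(1)] by (intro add_edge_del_edge) auto
  moreover have "add_edge ?F a c = G"
    using tri(2) D(5)[OF tri(2)] by (intro add_edge_del_edge)
  ultimately show ?thesis
    using arcs(3) D(6)[OF tri(1)] neq
    by (intro modular_relation_in_span[OF E, of b c a]) auto
qed

lemma cycle_edge_in_induced_path_in_span: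
  assumes G: "connected_graph_on n G"
    and path: "(u, v) \<in> parcs G" "(v, w) \<in> parcs G" "(u, w) \<notin> parcs G" "u \<noteq> w"
    and x: "(u, x) \<in> parcs G" "(x, w) \<in> parcs G" "x \<noteq> v"
  shows "chromatic_symmetric_function G \<in> non_isomorphic_span n G"
proof -
  note D = connected_graph_onD[OF G]
  have neq: "u \<noteq> v" "v \<noteq> w" "u \<noteq> x" "x \<noteq> w"
    using path x D(8) by auto
  let ?E = "del_edge G u v"
  have arcs: "(u, x) \<in> parcs ?E" "(x, w) \<in> parcs ?E" "(w, v) \<in> parcs ?E"
    using path x neq D(5)[OF path(2)] by auto
  then have "(u, v) \<in> (parcs ?E)\<^sup>*"
    by (meson converse_rtrancl_into_rtrancl r_into_rtrancl)
  with G have E: "connected_graph_on n ?E"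
    by (rule connected_graph_on_del_edge)
  have "add_edge ?E u v = G"
    using path(1) D(5)[OF path(1)] by (intro add_edge_del_edge)
  then show ?thesis
    using path neq D(6)[OF path(1)]
    by (intro modular_relation_in_span[OF E, of v w u]) auto
qed

lemma star_or_in_span:
  assumes G: "connected_graph_on n G" and n: "n \<ge> 4"
    and not_in_span: "chromatic_symmetric_function G \<notin> non_isomorphic_span n G"
  shows "graph_iso G (star_graph n)"
proof -
  note D = connected_graph_onD[OF G]
  have multipartite: "(u, v) \<in> parcs G \<or> (u, w) \<in> parcs G"
    if "(v, w) \<in> parcs G" "u \<in> pverts G" "u \<noteq> v" "u \<noteq> w" for u v w
    using that not_in_span modular_relation_in_span[OF G, of v w u G] by blast
  have no_triangle: "False"
    if tri: "(a, b) \<in> parcs G" "(b, c) \<in> parcs G" "(a, c) \<in> parcs G" for a b c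
  proof -
    have "card {a, b, c} < card (pverts G)"
      using D(3) n by (simp add: card_insert_if)
    then have "\<not> pverts G \<subseteq> {a, b, c}"
      using card_mono[of "{a, b, c}" "pverts G"] by auto
    then obtain d where d: "d \<in> pverts G" "d \<noteq> a" "d \<noteq> b" "d \<noteq> c"
      by blast
    \<comment> \<open>Each edge of the triangle has an end joined to \<open>d\<close>, so at most one corner is not.\<close>
    consider "(d, a) \<in> parcs G" "(d, b) \<in> parcs G" | "(d, a) \<in> parcs G" "(d, c) \<in> parcs G" |
        "(d, b) \<in> parcs G" "(d, c) \<in> parcs G"
      using multipartite[OF tri(1) d(1-3)] multipartite[OF tri(2) d(1,3,4)]
        multipartite[OF tri(3) d(1,2,4)] by blast
    then show False
    proof cases
      case 1
      then show False
        using diamond_in_span[OF G tri(1,3,2) _ _ d(4)] not_in_span by blast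
    next
      case 2
      then show False
        using diamond_in_span[OF G tri(3,1) D(5)[OF tri(2)] _ _ d(3)]
          not_in_span by blast
    next
      case 3
      then show False
        using diamond_in_span[OF G tri(2) D(5)[OF tri(1)] D(5)[OF tri(3)]
          _ _ d(2)] not_in_span by blast
    qed
  qed
  obtain u where u: "u \<in> pverts G"
    using G by (auto simp: connected_graph_on_iff)
  have "n \<ge> 2"
    using n by linarith
  from G this u obtain v where uv: "(u, v) \<in> parcs G"
    by (rule connected_graph_on_neighbour)
  \<comment> \<open>The sides of the complete bipartite graph are the neighbourhoods of \<open>u\<close> and of \<open>v\<close>.\<close>
  show ?thesis
  proof (cases "\<exists>a b. (u, a) \<in> parcs G \<and> a \<noteq> v \<and> (v, b) \<in> parcs G \<and> b \<noteq> u")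
    case True
    then obtain a b where ab: "(u, a) \<in> parcs G" "a \<noteq> v" "(v, b) \<in> parcs G" "b \<noteq> u"
      by blast
    have va: "(v, a) \<notin> parcs G"
      using no_triangle[OF uv _ ab(1)] by blast
    have ub: "(u, b) \<notin> parcs G"
      using no_triangle[OF uv ab(3)] by blast
    have "a \<noteq> b"
      using va ab(3) by blast
    then have "(a, b) \<in> parcs G"
      using multipartite[OF ab(3) D(7)[OF ab(1)] ab(2)] va D(5)[of a v] by blast
    then show ?thesis
      using cycle_edge_in_induced_path_in_span[OF G uv ab(3) ub ab(4)[symmetric] ab(1) _ ab(2)]
        not_in_span by blast
  next
    case False
    then have "(\<forall>a. (u, a) \<in> parcs G \<longrightarrow> a = v) \<or> (\<forall>b. (v, b) \<in> parcs G \<longrightarrow> b = u)"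
      by blast
    then obtain l c where lc: "(l, c) \<in> parcs G" and leaf: "\<And>a. (l, a) \<in> parcs G \<Longrightarrow> a = c"
      using uv D(5)[OF uv] by blast
    have adj: "(c, w) \<in> parcs G" if "w \<in> pverts G" "w \<noteq> c" for w
      using multipartite[OF lc that(1) _ that(2)] D(5)[OF lc] D(5)[of w l] D(5)[of w c]
        leaf[of w] that(2) by blast
    have "(x, y) \<notin> parcs G" if "x \<noteq> c" "y \<noteq> c" for x y
      using no_triangle[of c x y] adj[of x] adj[of y] that D(6,7)[of x y] by blast
    then show ?thesis
      using adj D(7)[OF lc] by (intro graph_iso_star_graphI[OF G]) auto
  qed
qed

theorem theorem1p3:
  fixes n :: nat and G :: "'a pair_pre_digraph"
  assumes "n \<ge> 4" and "connected_graph_on n G"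
  shows "chromatic_symmetric_function G \<notin>
           series.span {chromatic_symmetric_function H | H :: nat pair_pre_digraph.
                          connected_graph_on n H \<and> \<not> graph_iso G H}
         \<longleftrightarrow> graph_iso G (star_graph n)"
  using star_or_in_span[OF assms(2,1)] star_not_in_span[OF assms(2)] assms(1)
  unfolding non_isomorphic_span_def by auto

end
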